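(* Let $(\mathbb{X},d)$ be a complete separable metric space, and let $\Phi_1,\Phi_2$ be two independent point processes on $\mathbb{X}$ whose moment measures $M_{\Phi_1},M_{\Phi_2}$ are $\sigma$-finite. Let $\Phi=\Phi_1+\Phi_2$, so that $M_\Phi=M_{\Phi_1}+M_{\Phi_2}$, and for $j=1,2$ let $$p_j(x)=\frac{\mathrm{d}M_{\Phi_j}}{\mathrm{d}(M_{\Phi_1}+M_{\Phi_2})}(x)$$ be the Radon--Nikodym derivative, chosen so that $p_1,p_2\ge 0$ and $p_1+p_2=1$. Let $\{\mathsf{P}_{\Phi}^x\}_{x\in\mathbb{X}}$, $\{\mathsf{P}_{\Phi_1}^x\}_{x\in\mathbb{X}}$, $\{\mathsf{P}_{\Phi_2}^x\}_{x\in\mathbb{X}}$ be families of Palm distributions of $\Phi,\Phi_1,\Phi_2$ respectively. Then for $M_\Phi$-almost all $x\in\mathbb{X}$, the Palm version $\Phi_x=(\Phi_1+\Phi_2)_x$ is distributed as the mixture $$(\Phi_1+\Phi_2)_x\stackrel{d}{=}\begin{cases}\Phi_{1x}+\Phi_2 & \text{with probability } p_1(x),\\ \Phi_1+\Phi_{2x} & \text{with probability } p_2(x),\end{cases}$$ where $\Phi_{jx}\sim\mathsf{P}_{\Phi_j}^x$ and in each sum the two summands are independent. That is, for $M_\Phi$-almost all $x$ and all $L\in\mathcal{M}_{\mathbb{X}}$, $$\mathsf{P}_\Phi^x(L)=p_1(x)\,(\mathsf{P}_{\Phi_1}^x*\mathsf{P}_{\Phi_2})(L)+p_2(x)\,(\mathsf{P}_{\Phi_1}*\mathsf{P}_{\Phi_2}^x)(L),$$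 where $\mathsf{P}_{\Phi_j}$ is the law of $\Phi_j$ and, for probability measures $Q,R$ on $(\mathbb{M}_{\mathbb{X}},\mathcal{M}_{\mathbb{X}})$, $Q*R$ is the law of $\mu+\nu$ with $(\mu,\nu)\sim Q\otimes R$.
   Context: Let $\mathcal{X}$ be the Borel $\sigma$-algebra of $\mathbb{X}$. A counting measure is a locally finite measure $\mu$ on $(\mathbb{X},\mathcal{X})$ with $\mu(B)\in\mathbb{N}=\{0,1,2,\dots\}$ for every relatively compact $B\in\mathcal{X}$. $\mathbb{M}_{\mathbb{X}}$ is the set of counting measures and $\mathcal{M}_{\mathbb{X}}$ the smallest $\sigma$-algebra on it making all maps $\mu\mapsto\mu(B)$, $B\in\mathcal{X}$, measurable. A point process is a measurable map $\Phi:(\Omega,\mathcal{A},\mathsf{P})\to(\mathbb{M}_{\mathbb{X}},\mathcal{M}_{\mathbb{X}})$ from a probability space, with law $\mathsf{P}_\Phi=\mathsf{P}\circ\Phi^{-1}$. Its (first) moment measure is $M_\Phi(B)=\mathsf{E}[\Phi(B)]$, $B\in\mathcal{X}$. Its Campbell measure is the measure $\mathcal{C}_\Phi$ on $\mathbb{X}\times\mathbb{M}_{\mathbb{X}}$ determined by $\mathcal{C}_\Phi(B\times L)=\mathsf{E}[\Phi(B)\mathbf{1}_L(\Phi)]$ for $B\in\mathcal{X}$, $L\in\mathcal{M}_{\mathbb{X}}$. If $M_\Phi$ is $\sigma$-finite, a family of Palm distributions of $\Phi$ is a probability kernel $x\mapsto\mathsf{P}_\Phi^x$ from $\mathbb{X}$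 to $\mathbb{M}_{\mathbb{X}}$ such that $$\mathcal{C}_\Phi(B\times L)=\int_B\mathsf{P}_\Phi^x(L)\,M_\Phi(\mathrm{d}x)\quad\text{for all } B\in\mathcal{X},\ L\in\mathcal{M}_{\mathbb{X}}.$$ A point process $\Phi_x\sim\mathsf{P}_\Phi^x$ is called a Palm version of $\Phi$ at $x$. *)

theory Defs
  imports "HOL-Probability.Probability"
begin

section \<open>The measurable space of counting measures\<close>

text \<open>Local finiteness is the topological notion: every point has an open neighbourhood of finite
  measure. Without local compactness this does not follow from finiteness on relatively compact
  sets.\<close>

definition locally_finite_measure :: "'a::topological_space measure \<Rightarrow> bool" where
  "locally_finite_measure \<mu> \<longleftrightarrow> (\<forall>x. \<exists>U. open U \<and> x \<in> U \<and> emeasure \<mu> U < \<infinity>)"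

definition counting_measures :: "'a::polish_space measure set" where
  "counting_measures = {\<mu>. sets \<mu> = sets borel \<and> locally_finite_measure \<mu> \<and>
     (\<forall>B\<in>sets borel. compact (closure B) \<longrightarrow> emeasure \<mu> B \<in> \<nat>)}"

text \<open>Only the space and the \<open>\<sigma>\<close>-algebra of \<open>counting_space\<close> carry meaning.\<close>

definition counting_space :: "'a::polish_space measure measure" where
  "counting_space =
     (SUP B\<in>sets borel. vimage_algebra counting_measures (\<lambda>\<mu>. emeasure \<mu> B) borel)"

lemma space_counting_space: "space counting_space = counting_measures"
  by (auto simp: counting_space_def space_Sup_eq_UN)

lemma sets_counting_measures: "\<mu> \<in> space counting_space \<Longrightarrow> sets \<mu> = sets borel"
  by (simp add: space_counting_space counting_measures_def)

lemma measurable_emeasure_counting_space [measurable]: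
  "B \<in> sets borel \<Longrightarrow> (\<lambda>\<mu>. emeasure \<mu> B) \<in> borel_measurable counting_space"
  by (auto intro!: measurable_Sup1 measurable_vimage_algebra1 simp: counting_space_def)

lemma measurable_counting_spaceI:
  fixes f :: "'b \<Rightarrow> 'a::polish_space measure"
  assumes "\<And>x. x \<in> space M \<Longrightarrow> f x \<in> counting_measures"
    and "\<And>B. B \<in> sets borel \<Longrightarrow> (\<lambda>x. emeasure (f x) B) \<in> borel_measurable M"
  shows "f \<in> M \<rightarrow>\<^sub>M counting_space"
  unfolding counting_space_def
proof (rule measurable_Sup2)
  fix m :: "'a measure measure"
  assume "m \<in> (\<lambda>B. vimage_algebra counting_measures (\<lambda>\<mu>. emeasure \<mu> B) borel) ` sets borel"
  then show "f \<in> M \<rightarrow>\<^sub>M m"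
    using assms by (auto intro!: measurable_vimage_algebra2)
qed auto


section \<open>Superposition and convolution\<close>

definition add_measure :: "'a measure \<Rightarrow> 'a measure \<Rightarrow> 'a measure" where
  "add_measure \<mu> \<nu> = measure_of (space \<mu>) (sets \<mu>) (\<lambda>B. emeasure \<mu> B + emeasure \<nu> B)"

lemma space_add_measure [simp]: "space (add_measure \<mu> \<nu>) = space \<mu>"
  and sets_add_measure [simp]: "sets (add_measure \<mu> \<nu>) = sets \<mu>"
  by (simp_all add: add_measure_def)

lemma emeasure_add_measure:
  assumes "sets \<mu> = sets \<nu>" "B \<in> sets \<mu>"
  shows "emeasure (add_measure \<mu> \<nu>) B = emeasure \<mu> B + emeasure \<nu> B"
proof (rule emeasure_measure_of[OF add_measure_def])
  show "countably_additive (sets (add_measure \<mu> \<nu>)) (\<lambda>B. emeasure \<mu> B + emeasure \<nu> B)"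
    using assms(1) by (auto simp: countably_additive_def suminf_add[symmetric] suminf_emeasure)
qed (use assms sets.space_closed[of \<mu>] in \<open>simp_all add: positive_def\<close>)

lemma add_measure_in_counting_measures:
  assumes "\<mu> \<in> counting_measures" "\<nu> \<in> counting_measures"
  shows "add_measure \<mu> \<nu> \<in> counting_measures"
proof -
  have sets: "sets \<mu> = sets borel" "sets \<nu> = sets borel"
    using assms by (auto simp: counting_measures_def)
  have "locally_finite_measure (add_measure \<mu> \<nu>)"
    unfolding locally_finite_measure_def
  proof
    fix x
    obtain U V where UV: "open U" "x \<in> U" "emeasure \<mu> U < \<infinity>" "open V" "x \<in> V" "emeasure \<nu> V < \<infinity>"
      using assms unfolding counting_measures_def locally_finite_measure_def by blast
    have "emeasure \<mu> (U \<inter> V) \<le> emeasure \<mu> U" "emeasure \<nu> (U \<inter> V) \<le> emeasure \<nu> V"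
      using UV sets by (auto intro!: emeasure_mono)
    then have "emeasure (add_measure \<mu> \<nu>) (U \<inter> V) < \<infinity>"
      using UV sets by (subst emeasure_add_measure) (auto intro: le_less_trans)
    then show "\<exists>W. open W \<and> x \<in> W \<and> emeasure (add_measure \<mu> \<nu>) W < \<infinity>"
      using UV by (intro exI[of _ "U \<inter> V"]) auto
  qed
  moreover have "emeasure (add_measure \<mu> \<nu>) B \<in> \<nat>"
    if "B \<in> sets borel" "compact (closure B)" for B
  proof -
    have "emeasure \<mu> B \<in> \<nat>" "emeasure \<nu> B \<in> \<nat>"
      using assms that unfolding counting_measures_def by blast+
    then show ?thesis
      using that sets by (simp add: emeasure_add_measure)
  qed
  ultimately show ?thesis
    using sets by (simp add: counting_measures_def)
qed

lemma measurable_add_measure [measurable]: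
  fixes f g :: "'b \<Rightarrow> 'a::polish_space measure"
  assumes [measurable]: "f \<in> M \<rightarrow>\<^sub>M counting_space" "g \<in> M \<rightarrow>\<^sub>M counting_space"
  shows "(\<lambda>x. add_measure (f x) (g x)) \<in> M \<rightarrow>\<^sub>M counting_space"
proof (rule measurable_counting_spaceI)
  have sp: "f x \<in> space counting_space" "g x \<in> space counting_space" if "x \<in> space M" for x
    using that measurable_space[OF assms(1)] measurable_space[OF assms(2)] by blast+
  show "add_measure (f x) (g x) \<in> counting_measures" if "x \<in> space M" for x
    using sp[OF that] by (simp add: space_counting_space add_measure_in_counting_measures)
  fix B :: "'a set" assume [measurable]: "B \<in> sets borel"
  have "(\<lambda>x. emeasure (f x) B + emeasure (g x) B) \<in> borel_measurable M"
    by measurable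
  then show "(\<lambda>x. emeasure (add_measure (f x) (g x)) B) \<in> borel_measurable M"
    by (rule measurable_cong[THEN iffD1, rotated])
       (use sp in \<open>simp add: emeasure_add_measure sets_counting_measures\<close>)
qed

definition conv_law ::
  "'a::polish_space measure measure \<Rightarrow> 'a measure measure \<Rightarrow> 'a measure measure" where
  "conv_law Q R = distr (Q \<Otimes>\<^sub>M R) counting_space (\<lambda>(\<mu>, \<nu>). add_measure \<mu> \<nu>)"


section \<open>Point processes and Palm distributions\<close>

definition point_process :: "'w measure \<Rightarrow> ('w \<Rightarrow> 'a::polish_space measure) \<Rightarrow> bool" where
  "point_process P \<Phi> \<longleftrightarrow> prob_space P \<and> \<Phi> \<in> P \<rightarrow>\<^sub>M counting_space"

definition law :: "'w measure \<Rightarrow> ('w \<Rightarrow> 'a::polish_space measure) \<Rightarrow> 'a measure measure" where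
  "law P \<Phi> = distr P counting_space \<Phi>"

definition moment_measure :: "'w measure \<Rightarrow> ('w \<Rightarrow> 'a::polish_space measure) \<Rightarrow> 'a measure" where
  "moment_measure P \<Phi> = measure_of UNIV (sets borel) (\<lambda>B. \<integral>\<^sup>+\<omega>. emeasure (\<Phi> \<omega>) B \<partial>P)"

text \<open>The Campbell measure is given on all of the product \<open>\<sigma>\<close>-algebra; its defining values on
  rectangles are lemma \<open>emeasure_campbell_measure_Times\<close> below.\<close>

definition campbell_measure ::
  "'w measure \<Rightarrow> ('w \<Rightarrow> 'a::polish_space measure) \<Rightarrow> ('a \<times> 'a measure) measure" where
  "campbell_measure P \<Phi> =
     measure_of (UNIV \<times> counting_measures) (sets (borel \<Otimes>\<^sub>M counting_space))
       (\<lambda>A. \<integral>\<^sup>+\<omega>. emeasure (\<Phi> \<omega>) {x. (x, \<Phi> \<omega>) \<in> A} \<partial>P)"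

text \<open>\<open>prob_algebra counting_space\<close> is the space of probability measures on the counting measures,
  so that the first conjunct says that \<open>K\<close> is a probability kernel. The notion is meant for
  processes with \<open>\<sigma>\<close>-finite moment measure.\<close>

definition palm_family ::
  "'w measure \<Rightarrow> ('w \<Rightarrow> 'a::polish_space measure) \<Rightarrow> ('a \<Rightarrow> 'a measure measure) \<Rightarrow> bool" where
  "palm_family P \<Phi> K \<longleftrightarrow> K \<in> borel \<rightarrow>\<^sub>M prob_algebra counting_space \<and>
     (\<forall>B\<in>sets borel. \<forall>L\<in>sets counting_space.
        emeasure (campbell_measure P \<Phi>) (B \<times> L) =
          (\<integral>\<^sup>+x\<in>B. emeasure (K x) L \<partial>moment_measure P \<Phi>))"


section \<open>The moment and Campbell measures have the intended values\<close>

lemma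
  fixes \<Phi> :: "'w \<Rightarrow> 'a::polish_space measure"
  shows space_moment_measure [simp]: "space (moment_measure P \<Phi>) = UNIV"
  and sets_moment_measure [simp, measurable_cong]: "sets (moment_measure P \<Phi>) = sets borel"
  using sets.sigma_sets_eq[of "borel :: 'a measure"] by (simp_all add: moment_measure_def)

lemma emeasure_moment_measure:
  fixes \<Phi> :: "'w \<Rightarrow> 'a::polish_space measure"
  assumes \<Phi>: "\<Phi> \<in> P \<rightarrow>\<^sub>M counting_space" and B: "B \<in> sets borel"
  shows "emeasure (moment_measure P \<Phi>) B = (\<integral>\<^sup>+\<omega>. emeasure (\<Phi> \<omega>) B \<partial>P)"
proof (rule emeasure_measure_of[OF moment_measure_def])
  show "countably_additive (sets (moment_measure P \<Phi>)) (\<lambda>B. \<integral>\<^sup>+\<omega>. emeasure (\<Phi> \<omega>) B \<partial>P)"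
    unfolding countably_additive_def
  proof safe
    fix A :: "nat \<Rightarrow> 'a set"
    assume "range A \<subseteq> sets (moment_measure P \<Phi>)" and disj: "disjoint_family A"
    then have A: "range A \<subseteq> sets borel" by simp
    then have "(\<lambda>\<omega>. emeasure (\<Phi> \<omega>) (A i)) \<in> borel_measurable P" for i
      by (intro measurable_compose[OF \<Phi> measurable_emeasure_counting_space]) auto
    then have "(\<Sum>i. \<integral>\<^sup>+\<omega>. emeasure (\<Phi> \<omega>) (A i) \<partial>P) = (\<integral>\<^sup>+\<omega>. (\<Sum>i. emeasure (\<Phi> \<omega>) (A i)) \<partial>P)"
      by (simp add: nn_integral_suminf)
    also have "\<dots> = (\<integral>\<^sup>+\<omega>. emeasure (\<Phi> \<omega>) (\<Union>i. A i) \<partial>P)"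
      using A disj measurable_space[OF \<Phi>]
      by (intro nn_integral_cong suminf_emeasure) (auto dest: sets_counting_measures)
    finally show "(\<Sum>i. \<integral>\<^sup>+\<omega>. emeasure (\<Phi> \<omega>) (A i) \<partial>P) = (\<integral>\<^sup>+\<omega>. emeasure (\<Phi> \<omega>) (\<Union>i. A i) \<partial>P)" .
  qed
qed (use B in \<open>auto simp: positive_def\<close>)

lemma point_process_add:
  "point_process P \<Phi>\<^sub>1 \<Longrightarrow> point_process P \<Phi>\<^sub>2 \<Longrightarrow> point_process P (\<lambda>\<omega>. add_measure (\<Phi>\<^sub>1 \<omega>) (\<Phi>\<^sub>2 \<omega>))"
  by (auto simp: point_process_def)

lemma moment_measure_add:
  assumes [measurable]: "\<Phi>\<^sub>1 \<in> P \<rightarrow>\<^sub>M counting_space" "\<Phi>\<^sub>2 \<in> P \<rightarrow>\<^sub>M counting_space"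
  shows "moment_measure P (\<lambda>\<omega>. add_measure (\<Phi>\<^sub>1 \<omega>) (\<Phi>\<^sub>2 \<omega>)) =
    add_measure (moment_measure P \<Phi>\<^sub>1) (moment_measure P \<Phi>\<^sub>2)"
proof (rule measure_eqI)
  fix B assume "B \<in> sets (moment_measure P (\<lambda>\<omega>. add_measure (\<Phi>\<^sub>1 \<omega>) (\<Phi>\<^sub>2 \<omega>)))"
  then have B[measurable]: "B \<in> sets borel" by simp
  have "(\<integral>\<^sup>+\<omega>. emeasure (add_measure (\<Phi>\<^sub>1 \<omega>) (\<Phi>\<^sub>2 \<omega>)) B \<partial>P) =
      (\<integral>\<^sup>+\<omega>. emeasure (\<Phi>\<^sub>1 \<omega>) B + emeasure (\<Phi>\<^sub>2 \<omega>) B \<partial>P)"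
    using assms[THEN measurable_space]
    by (intro nn_integral_cong emeasure_add_measure) (simp_all add: sets_counting_measures)
  also have "\<dots> = (\<integral>\<^sup>+\<omega>. emeasure (\<Phi>\<^sub>1 \<omega>) B \<partial>P) + (\<integral>\<^sup>+\<omega>. emeasure (\<Phi>\<^sub>2 \<omega>) B \<partial>P)"
    by (intro nn_integral_add) measurable
  finally show "emeasure (moment_measure P (\<lambda>\<omega>. add_measure (\<Phi>\<^sub>1 \<omega>) (\<Phi>\<^sub>2 \<omega>))) B =
      emeasure (add_measure (moment_measure P \<Phi>\<^sub>1) (moment_measure P \<Phi>\<^sub>2)) B"
    using B by (simp add: emeasure_moment_measure emeasure_add_measure)
qed simp

lemma measurable_emeasure_section_finite:
  assumes A: "A \<in> sets (borel \<Otimes>\<^sub>M counting_space)" and U[measurable]: "U \<in> sets borel"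
  shows "(\<lambda>\<mu>. if emeasure \<mu> U < \<infinity> then emeasure \<mu> (U \<inter> {x. (x, \<mu>) \<in> A}) else 0)
    \<in> borel_measurable (counting_space :: 'a::polish_space measure measure)"
    (is "?f A \<in> _")
proof -
  let ?N = "counting_space :: 'a measure measure"
  let ?G = "{a \<times> b | a b. a \<in> sets (borel :: 'a measure) \<and> b \<in> sets ?N}"
  have sec: "{x. (x, \<mu>) \<in> A} \<in> sets borel" if "A \<in> sets (borel \<Otimes>\<^sub>M ?N)" for A and \<mu> :: "'a measure"
    using sets_Pair2[OF that, of \<mu>] by (simp add: vimage_def)
  have sig: "sets (borel \<Otimes>\<^sub>M ?N) = sigma_sets (UNIV \<times> space ?N) ?G"
    by (simp add: sets_pair_measure)
  have closed: "?G \<subseteq> Pow (UNIV \<times> space ?N)" by (auto dest: sets.sets_into_space)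
  from A have "A \<in> sigma_sets (UNIV \<times> space ?N) ?G" by (simp add: sig)
  from Int_stable_pair_measure_generator closed this show ?thesis
  proof (induct rule: sigma_sets_induct_disjoint)
    case (basic A)
    then obtain a b where A: "A = a \<times> b" and [measurable]: "a \<in> sets borel" "b \<in> sets ?N" by auto
    have "(\<lambda>\<mu>. if emeasure \<mu> U < \<infinity> then emeasure \<mu> (U \<inter> a) * indicator b \<mu> else 0)
        \<in> borel_measurable ?N"
      by measurable
    then show ?case
      by (rule measurable_cong[THEN iffD1, rotated]) (auto simp: A indicator_def)
  next
    case empty
    have "?f {} = (\<lambda>_. 0)" by (rule ext) simp
    then show ?case by simp
  next
    case (compl A)
    note [measurable] = compl(2)
    have "(\<lambda>\<mu>. (if emeasure \<mu> U < \<infinity> then emeasure \<mu> U else 0) - ?f A \<mu>) \<in> borel_measurable ?N"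
      by measurable
    then show ?case
    proof (rule measurable_cong[THEN iffD1, rotated])
      fix \<mu> assume \<mu>: "\<mu> \<in> space ?N"
      have eq: "U \<inter> {x. (x, \<mu>) \<in> UNIV \<times> space ?N - A} = U - (U \<inter> {x. (x, \<mu>) \<in> A})"
        using \<mu> by auto
      have "emeasure \<mu> (U - (U \<inter> {x. (x, \<mu>) \<in> A})) = emeasure \<mu> U - emeasure \<mu> (U \<inter> {x. (x, \<mu>) \<in> A})"
        if fin: "emeasure \<mu> U < \<infinity>"
      proof (rule emeasure_Diff)
        have [measurable]: "{x. (x, \<mu>) \<in> A} \<in> sets borel" using compl by (intro sec) (simp add: sig)
        show *: "U \<inter> {x. (x, \<mu>) \<in> A} \<in> sets \<mu>" using \<mu> by (simp add: sets_counting_measures)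
        show "U \<in> sets \<mu>" using \<mu> by (simp add: sets_counting_measures)
        then have "emeasure \<mu> (U \<inter> {x. (x, \<mu>) \<in> A}) \<le> emeasure \<mu> U" by (intro emeasure_mono) auto
        with fin show "emeasure \<mu> (U \<inter> {x. (x, \<mu>) \<in> A}) \<noteq> \<infinity>" by (auto simp: top_unique)
      qed auto
      then show "(if emeasure \<mu> U < \<infinity> then emeasure \<mu> U else 0) - ?f A \<mu> = ?f (UNIV \<times> space ?N - A) \<mu>"
        by (simp only: eq) simp
    qed
  next
    case (union A)
    note [measurable] = union(3)
    have "(\<lambda>\<mu>. \<Sum>i. ?f (A i) \<mu>) \<in> borel_measurable ?N" by measurable
    then show ?case
    proof (rule measurable_cong[THEN iffD1, rotated])
      fix \<mu> assume \<mu>: "\<mu> \<in> space ?N"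
      have "(\<Sum>i. emeasure \<mu> (U \<inter> {x. (x, \<mu>) \<in> A i})) = emeasure \<mu> (\<Union>i. U \<inter> {x. (x, \<mu>) \<in> A i})"
      proof (rule suminf_emeasure)
        have "{x. (x, \<mu>) \<in> A i} \<in> sets borel" for i using union by (intro sec) (auto simp: sig)
        then show "range (\<lambda>i. U \<inter> {x. (x, \<mu>) \<in> A i}) \<subseteq> sets \<mu>" using \<mu> by (auto simp: sets_counting_measures)
        show "disjoint_family (\<lambda>i. U \<inter> {x. (x, \<mu>) \<in> A i})"
          using union(1) unfolding disjoint_family_on_def by blast
      qed
      moreover have "(\<Union>i. U \<inter> {x. (x, \<mu>) \<in> A i}) = U \<inter> {x. (x, \<mu>) \<in> (\<Union>i. A i)}" by auto
      ultimately show "(\<Sum>i. ?f (A i) \<mu>) = ?f (\<Union>i. A i) \<mu>" by simp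
    qed
  qed
qed

lemma measurable_emeasure_section:
  assumes A: "A \<in> sets (borel \<Otimes>\<^sub>M counting_space)"
  shows "(\<lambda>\<mu>. emeasure \<mu> {x. (x, \<mu>) \<in> A})
    \<in> borel_measurable (counting_space :: 'a::polish_space measure measure)"
proof -
  let ?N = "counting_space :: 'a measure measure"
  obtain \<B> :: "'a set set" where \<B>: "countable \<B>" "topological_basis \<B>"
    using ex_countable_basis by auto
  define U where "U = from_nat_into (insert {} \<B>)"
  have rU: "range U = insert {} \<B>" unfolding U_def using \<B> by (intro range_from_nat_into) auto
  have "open (U i)" for i
    using rU \<B>(2) by (metis insertE open_empty rangeI topological_basis_open)
  then have U[measurable]: "U i \<in> sets borel" for i by auto
  define E where "E i = {z \<in> space (borel \<Otimes>\<^sub>M ?N). fst z \<in> U i \<and> emeasure (snd z) (U i) < \<infinity> \<and>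
    (\<forall>j<i. \<not> (fst z \<in> U j \<and> emeasure (snd z) (U j) < \<infinity>))}" for i
  have E[measurable]: "E i \<in> sets (borel \<Otimes>\<^sub>M ?N)" for i unfolding E_def by measurable
  have AE: "A \<inter> E i \<in> sets (borel \<Otimes>\<^sub>M ?N)" for i using A E by auto
  note [measurable] = measurable_emeasure_section_finite[OF AE U]
  have "(\<lambda>\<mu>. \<Sum>i. if emeasure \<mu> (U i) < \<infinity> then emeasure \<mu> (U i \<inter> {x. (x, \<mu>) \<in> A \<inter> E i}) else 0)
      \<in> borel_measurable ?N"
    by measurable
  then show ?thesis
  proof (rule measurable_cong[THEN iffD1, rotated])
    fix \<mu> assume \<mu>: "\<mu> \<in> space ?N"
    let ?D = "\<lambda>i. {x. (x, \<mu>) \<in> A \<inter> E i}"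
    have "(\<Sum>i. if emeasure \<mu> (U i) < \<infinity> then emeasure \<mu> (U i \<inter> ?D i) else 0) = (\<Sum>i. emeasure \<mu> (?D i))"
    proof (rule suminf_cong)
      fix i
      have "?D i \<subseteq> U i" by (auto simp: E_def)
      moreover have "?D i = {}" if "\<not> emeasure \<mu> (U i) < \<infinity>" using that by (auto simp: E_def)
      ultimately show "(if emeasure \<mu> (U i) < \<infinity> then emeasure \<mu> (U i \<inter> ?D i) else 0) = emeasure \<mu> (?D i)"
        by (cases "emeasure \<mu> (U i) < \<infinity>") (simp_all only: Int_absorb1 not_False_eq_True if_True if_False emeasure_empty)
    qed
    also have "\<dots> = emeasure \<mu> (\<Union>i. ?D i)"
    proof (rule suminf_emeasure)
      have "?D i \<in> sets borel" for i using sets_Pair2[OF AE[of i], of \<mu>] by (simp add: vimage_def)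
      then show "range ?D \<subseteq> sets \<mu>" using \<mu> by (auto simp: sets_counting_measures)
      have lt: "?D i \<inter> ?D j = {}" if "i < j" for i j using that by (auto simp: E_def)
      then show "disjoint_family ?D"
        unfolding disjoint_family_on_def
      proof (intro ballI impI)
        fix i j :: nat assume "i \<noteq> j"
        then consider "i < j" | "j < i" by linarith
        then show "?D i \<inter> ?D j = {}"
          using lt[of i j] lt[of j i] by cases (simp_all only: Int_commute)
      qed
    qed
    also have "(\<Union>i. ?D i) = {x. (x, \<mu>) \<in> A}"
    proof safe
      fix x assume x: "(x, \<mu>) \<in> A"
      obtain V where V: "open V" "x \<in> V" "emeasure \<mu> V < \<infinity>"
        using \<mu> unfolding space_counting_space counting_measures_def locally_finite_measure_def by blast
      then obtain W where W: "W \<in> \<B>" "x \<in> W" "W \<subseteq> V"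
        using \<B>(2) by (metis topological_basisE)
      then obtain i where i: "U i = W" using rU by (metis insertI2 rangeE)
      have "emeasure \<mu> W \<le> emeasure \<mu> V"
        using W V \<mu> by (intro emeasure_mono) (auto simp: sets_counting_measures)
      with V have "x \<in> U i \<and> emeasure \<mu> (U i) < \<infinity>" using W i by auto
      from LeastI[of "\<lambda>i. x \<in> U i \<and> emeasure \<mu> (U i) < \<infinity>", OF this]
      have "(x, \<mu>) \<in> E (LEAST i. x \<in> U i \<and> emeasure \<mu> (U i) < \<infinity>)"
        using \<mu> by (auto simp: E_def space_pair_measure dest: not_less_Least)
      with x show "x \<in> (\<Union>i. ?D i)" by blast
    qed
    finally show "(\<Sum>i. if emeasure \<mu> (U i) < \<infinity> then emeasure \<mu> (U i \<inter> ?D i) else 0) = emeasure \<mu> {x. (x, \<mu>) \<in> A}" .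
  qed
qed

lemma sets_campbell_measure [simp]:
  fixes \<Phi> :: "'w \<Rightarrow> 'a::polish_space measure"
  shows "sets (campbell_measure P \<Phi>) = sets (borel \<Otimes>\<^sub>M counting_space)"
  using sets.sigma_sets_eq[of "borel \<Otimes>\<^sub>M (counting_space :: 'a measure measure)"]
    sets.space_closed[of "borel \<Otimes>\<^sub>M (counting_space :: 'a measure measure)"]
  unfolding campbell_measure_def
  by (subst sets_measure_of) (simp_all add: space_pair_measure space_counting_space)

lemma emeasure_campbell_measure:
  fixes \<Phi> :: "'w \<Rightarrow> 'a::polish_space measure"
  assumes \<Phi>: "\<Phi> \<in> P \<rightarrow>\<^sub>M counting_space" and A: "A \<in> sets (borel \<Otimes>\<^sub>M counting_space)"
  shows "emeasure (campbell_measure P \<Phi>) A = (\<integral>\<^sup>+\<omega>. emeasure (\<Phi> \<omega>) {x. (x, \<Phi> \<omega>) \<in> A} \<partial>P)"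
proof (rule emeasure_measure_of[OF campbell_measure_def])
  show "sets (borel \<Otimes>\<^sub>M counting_space) \<subseteq> Pow (UNIV \<times> (counting_measures :: 'a measure set))"
    using sets.space_closed[of "borel \<Otimes>\<^sub>M (counting_space :: 'a measure measure)"]
    by (simp add: space_pair_measure space_counting_space)
  show "countably_additive (sets (campbell_measure P \<Phi>))
      (\<lambda>A. \<integral>\<^sup>+\<omega>. emeasure (\<Phi> \<omega>) {x. (x, \<Phi> \<omega>) \<in> A} \<partial>P)"
    unfolding countably_additive_def
  proof safe
    fix A :: "nat \<Rightarrow> ('a \<times> 'a measure) set"
    assume "range A \<subseteq> sets (campbell_measure P \<Phi>)" and disj: "disjoint_family A"
    then have A: "A i \<in> sets (borel \<Otimes>\<^sub>M counting_space)" for i by auto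
    have sec: "{x. (x, \<mu>) \<in> A i} \<in> sets borel" for i \<mu>
      using sets_Pair2[OF A[of i], of \<mu>] by (simp add: vimage_def)
    have "(\<Sum>i. \<integral>\<^sup>+\<omega>. emeasure (\<Phi> \<omega>) {x. (x, \<Phi> \<omega>) \<in> A i} \<partial>P) =
        (\<integral>\<^sup>+\<omega>. (\<Sum>i. emeasure (\<Phi> \<omega>) {x. (x, \<Phi> \<omega>) \<in> A i}) \<partial>P)"
      using measurable_compose[OF \<Phi> measurable_emeasure_section[OF A]] by (simp add: nn_integral_suminf)
    also have "\<dots> = (\<integral>\<^sup>+\<omega>. emeasure (\<Phi> \<omega>) {x. (x, \<Phi> \<omega>) \<in> (\<Union>i. A i)} \<partial>P)"
    proof (rule nn_integral_cong)
      fix \<omega> assume "\<omega> \<in> space P"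
      then have "\<Phi> \<omega> \<in> space counting_space" using measurable_space[OF \<Phi>] by auto
      then have "(\<Sum>i. emeasure (\<Phi> \<omega>) {x. (x, \<Phi> \<omega>) \<in> A i}) = emeasure (\<Phi> \<omega>) (\<Union>i. {x. (x, \<Phi> \<omega>) \<in> A i})"
      proof (intro suminf_emeasure)
        assume "\<Phi> \<omega> \<in> space counting_space"
        then show "range (\<lambda>i. {x. (x, \<Phi> \<omega>) \<in> A i}) \<subseteq> sets (\<Phi> \<omega>)"
          using sec by (auto simp: sets_counting_measures)
        show "disjoint_family (\<lambda>i. {x. (x, \<Phi> \<omega>) \<in> A i})"
          using disj unfolding disjoint_family_on_def by blast
      qed
      also have "(\<Union>i. {x. (x, \<Phi> \<omega>) \<in> A i}) = {x. (x, \<Phi> \<omega>) \<in> (\<Union>i. A i)}" by auto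
      finally show "(\<Sum>i. emeasure (\<Phi> \<omega>) {x. (x, \<Phi> \<omega>) \<in> A i}) = emeasure (\<Phi> \<omega>) {x. (x, \<Phi> \<omega>) \<in> (\<Union>i. A i)}" .
    qed
    finally show "(\<Sum>i. \<integral>\<^sup>+\<omega>. emeasure (\<Phi> \<omega>) {x. (x, \<Phi> \<omega>) \<in> A i} \<partial>P) =
        (\<integral>\<^sup>+\<omega>. emeasure (\<Phi> \<omega>) {x. (x, \<Phi> \<omega>) \<in> (\<Union>i. A i)} \<partial>P)" .
  qed
qed (use A in \<open>auto simp: positive_def\<close>)

lemma emeasure_campbell_measure_Times:
  assumes "\<Phi> \<in> P \<rightarrow>\<^sub>M counting_space" "B \<in> sets borel" "L \<in> sets counting_space"
  shows "emeasure (campbell_measure P \<Phi>) (B \<times> L) =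
    (\<integral>\<^sup>+\<omega>. emeasure (\<Phi> \<omega>) B * indicator L (\<Phi> \<omega>) \<partial>P)"
proof -
  have "emeasure (\<Phi> \<omega>) {x. (x, \<Phi> \<omega>) \<in> B \<times> L} = emeasure (\<Phi> \<omega>) B * indicator L (\<Phi> \<omega>)" for \<omega>
    by (cases "\<Phi> \<omega> \<in> L") simp_all
  then show ?thesis
    using assms by (simp add: emeasure_campbell_measure)
qed

end

theory Submission
  imports Defs
begin

text \<open>
  By independence, conditioning on \<open>\<Phi>\<^sub>2\<close> turns \<open>E[\<Phi>\<^sub>1(B) 1\<^sub>L(\<Phi>\<^sub>1 + \<Phi>\<^sub>2)]\<close> into \<open>E[\<Phi>\<^sub>1(B) f(\<Phi>\<^sub>1)]\<close>, where
  \<open>f \<mu> = P(\<mu> + \<Phi>\<^sub>2 \<in> L)\<close>. The Palm formula of \<open>\<Phi>\<^sub>1\<close>, extended from indicators to functions, evaluates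
  this as the integral over \<open>B\<close> of the convolution of the Palm distribution with the law of \<open>\<Phi>\<^sub>2\<close>. Adding the
  symmetric term identifies, for each fixed \<open>L\<close>, both sides of the claim as densities of \<open>B \<mapsto> C\<^sub>\<Phi>(B \<times> L)\<close>
  with respect to the \<open>\<sigma>\<close>-finite moment measure, so they agree almost everywhere. A null set that does not
  depend on \<open>L\<close> exists because the \<open>\<sigma>\<close>-algebra on counting measures has a countable generating
  \<open>\<pi>\<close>-system: local finiteness makes \<open>\<mu>\<close> measurably determined by its values on a countable basis.
\<close>

section \<open>Countable \<pi>-systems and bases closed under finite unions and
  intersections\<close>

text \<open>Intersecting with \<open>\<Omega>\<close> turns the empty intersection, which is
  \<open>UNIV\<close>, into \<open>\<Omega>\<close>. For \<open>G \<subseteq> Pow \<Omega>\<close>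
  this is thus the \<pi>-system generated by \<open>G\<close> together with the whole space.\<close>

definition finite_Inters :: "'a set \<Rightarrow> 'a set set \<Rightarrow> 'a set set" where
  "finite_Inters \<Omega> G = (\<lambda>F. \<Omega> \<inter> \<Inter>F) ` {F. finite F \<and> F \<subseteq> G}"

lemma countable_finite_Inters: "countable G \<Longrightarrow> countable (finite_Inters \<Omega> G)"
  by (simp add: finite_Inters_def countable_Collect_finite_subset)

lemma finite_Inters_Int:
  assumes "A \<in> finite_Inters \<Omega> G" "B \<in> finite_Inters \<Omega> G"
  shows "A \<inter> B \<in> finite_Inters \<Omega> G"
proof -
  obtain F H where "A = \<Omega> \<inter> \<Inter>F" "B = \<Omega> \<inter> \<Inter>H" "finite F" "finite H" "F \<subseteq> G" "H \<subseteq> G"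
    using assms by (auto simp: finite_Inters_def)
  then show ?thesis
    unfolding finite_Inters_def by (intro image_eqI[of _ _ "F \<union> H"]) auto
qed

lemma space_in_finite_Inters: "\<Omega> \<in> finite_Inters \<Omega> G"
  unfolding finite_Inters_def by (rule image_eqI[of _ _ "{}"]) auto

lemma subset_finite_Inters: "G \<subseteq> Pow \<Omega> \<Longrightarrow> G \<subseteq> finite_Inters \<Omega> G"
  unfolding finite_Inters_def by (auto intro!: image_eqI[of _ _ "{_}"])

lemma sigma_sets_finite_Inters:
  assumes G: "G \<subseteq> Pow \<Omega>"
  shows "sigma_sets \<Omega> (finite_Inters \<Omega> G) = sigma_sets \<Omega> G"
proof (rule sigma_sets_eqI)
  interpret sigma_algebra \<Omega> "sigma_sets \<Omega> G" by (rule sigma_algebra_sigma_sets[OF G])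
  fix A assume "A \<in> finite_Inters \<Omega> G"
  then obtain F where F: "A = \<Omega> \<inter> \<Inter>F" "finite F" "F \<subseteq> G" by (auto simp: finite_Inters_def)
  from F(2,3) have "\<Omega> \<inter> \<Inter>F \<in> sigma_sets \<Omega> G"
  proof induct
    case (insert B F)
    then have "B \<inter> (\<Omega> \<inter> \<Inter>F) \<in> sigma_sets \<Omega> G" by (intro Int[of B]) auto
    moreover have "B \<inter> (\<Omega> \<inter> \<Inter>F) = \<Omega> \<inter> \<Inter>(insert B F)" by auto
    ultimately show ?case by (simp only:)
  qed auto
  with F show "A \<in> sigma_sets \<Omega> G" by simp
qed (use subset_finite_Inters[OF G] in auto)

text \<open>Take all finite unions of finite intersections from a countable basis; distributivity
  gives closure under intersection. Closure under intersection makes the basis a \<pi>-system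
  generating the Borel sets, closure under union lets the space be exhausted by an increasing
  sequence of basis sets, and the empty set is a harmless substitute for basis sets of infinite
  measure.\<close>

lemma ex_countable_basis_lattice:
  obtains \<W> :: "'a::second_countable_topology set set"
  where "countable \<W>" "topological_basis \<W>" "{} \<in> \<W>"
    "Int_stable \<W>" "\<forall>F. finite F \<and> F \<subseteq> \<W> \<longrightarrow> \<Union>F \<in> \<W>"
proof -
  obtain \<B> :: "'a set set" where \<B>: "countable \<B>" "topological_basis \<B>"
    using ex_countable_basis by auto
  define \<C> where "\<C> = finite_Inters UNIV \<B>"
  define \<W> where "\<W> = Union ` {F. finite F \<and> F \<subseteq> \<C>}"
  have op: "open A" if "A \<in> \<C>" for A
    using that \<B>(2) by (auto simp: \<C>_def finite_Inters_def intro!: open_Inter dest: topological_basis_open)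
  have sub: "\<B> \<subseteq> \<W>"
  proof
    fix A assume "A \<in> \<B>"
    then have "A \<in> \<C>" unfolding \<C>_def using subset_finite_Inters[of \<B> UNIV] by auto
    then show "A \<in> \<W>" unfolding \<W>_def by (intro image_eqI[of _ _ "{A}"]) auto
  qed
  show thesis
  proof
    show "countable \<W>"
      using \<B>(1) unfolding \<W>_def \<C>_def
      by (intro countable_image countable_Collect_finite_subset countable_finite_Inters)
    show "topological_basis \<W>"
    proof (rule topological_basisI)
      show "open A" if "A \<in> \<W>" for A using that op by (auto simp: \<W>_def)
      show "\<exists>B'\<in>\<W>. x \<in> B' \<and> B' \<subseteq> O'" if "open O'" "x \<in> O'" for O' x
        using that sub topological_basisE[OF \<B>(2)] by (metis subsetD)
    qed
    show "{} \<in> \<W>" unfolding \<W>_def by (intro image_eqI[of _ _ "{}"]) auto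
    show "Int_stable \<W>"
    proof (rule Int_stableI)
      fix A B assume AB: "A \<in> \<W>" "B \<in> \<W>"
      obtain F H where FH: "A = \<Union>F" "B = \<Union>H" "finite F" "finite H" "F \<subseteq> \<C>" "H \<subseteq> \<C>"
        using AB by (auto simp: \<W>_def)
      have "(\<lambda>(a, b). a \<inter> b) ` (F \<times> H) \<subseteq> \<C>"
        using FH unfolding \<C>_def by (auto intro!: finite_Inters_Int)
      moreover have "A \<inter> B = \<Union>((\<lambda>(a, b). a \<inter> b) ` (F \<times> H))" using FH by auto
      ultimately show "A \<inter> B \<in> \<W>"
        using FH unfolding \<W>_def by (intro image_eqI[of _ _ "(\<lambda>(a, b). a \<inter> b) ` (F \<times> H)"]) auto
    qed
    show "\<forall>F. finite F \<and> F \<subseteq> \<W> \<longrightarrow> \<Union>F \<in> \<W>"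
    proof (intro allI impI)
      fix F assume F: "finite F \<and> F \<subseteq> \<W>"
      then have "\<forall>A\<in>F. \<exists>H. finite H \<and> H \<subseteq> \<C> \<and> A = \<Union>H" by (auto simp: \<W>_def)
      then obtain H where H: "\<forall>A\<in>F. finite (H A) \<and> H A \<subseteq> \<C> \<and> A = \<Union>(H A)" by metis
      then have "\<Union>F = (\<Union>A\<in>F. \<Union>(H A))" by simp
      also have "\<dots> = \<Union>(\<Union>A\<in>F. H A)" by blast
      finally show "\<Union>F \<in> \<W>"
        using F H unfolding \<W>_def by (intro image_eqI[of _ _ "\<Union>A\<in>F. H A"]) auto
    qed
  qed
qed

section \<open>A countable generator of the \<sigma>-algebra on counting measures\<close>

text \<open>Dynkin induction over \<open>B\<close> with \<open>W\<close> fixed: for \<open>B\<close>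
  in the basis, \<open>W \<inter> B\<close> is again a basis set, so its evaluation is measurable by
  assumption. The space \<open>S\<close> is left general because the lemma is meant for a
  \<sigma>-algebra of which only the measurability of evaluations on basis sets is known.\<close>

lemma measurable_emeasure_Int_if_finite:
  fixes S :: "'a::polish_space measure measure"
  assumes sets: "\<And>\<mu>. \<mu> \<in> space S \<Longrightarrow> sets \<mu> = sets borel"
    and \<W>: "countable \<W>" "topological_basis \<W>" "Int_stable \<W>"
    and meas: "\<And>W. W \<in> \<W> \<Longrightarrow> (\<lambda>\<mu>. emeasure \<mu> W) \<in> borel_measurable S"
    and W: "W \<in> \<W>" and B: "B \<in> sets borel"
  shows "(\<lambda>\<mu>. if emeasure \<mu> W < \<infinity> then emeasure \<mu> (W \<inter> B) else 0) \<in> borel_measurable S"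
    (is "?f B \<in> _")
proof -
  note [measurable] = meas[OF W]
  have Wb: "W \<in> sets borel" using W \<W>(2) by (auto dest: topological_basis_open)
  have sig: "sets (borel :: 'a measure) = sigma_sets UNIV \<W>"
    by (simp add: borel_eq_countable_basis[OF \<W>(1,2)])
  note \<W>(3)
  moreover have "\<W> \<subseteq> Pow UNIV" by simp
  moreover from B have "B \<in> sigma_sets UNIV \<W>" by (simp add: sig)
  ultimately show ?thesis
  proof (induct rule: sigma_sets_induct_disjoint)
    case (basic B)
    then have [measurable]: "(\<lambda>\<mu>. emeasure \<mu> (W \<inter> B)) \<in> borel_measurable S"
      using W \<W>(3) by (intro meas Int_stableD)
    show ?case by measurable
  next
    case empty
    have "?f {} = (\<lambda>_. 0)" by (rule ext) simp
    then show ?case by simp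
  next
    case (compl B)
    note [measurable] = compl(2)
    have "(\<lambda>\<mu>. (if emeasure \<mu> W < \<infinity> then emeasure \<mu> W else 0) - ?f B \<mu>) \<in> borel_measurable S"
      by measurable
    then show ?case
    proof (rule measurable_cong[THEN iffD1, rotated])
      fix \<mu> assume \<mu>: "\<mu> \<in> space S"
      have "emeasure \<mu> (W - W \<inter> B) = emeasure \<mu> W - emeasure \<mu> (W \<inter> B)" if fin: "emeasure \<mu> W < \<infinity>"
      proof (rule emeasure_Diff)
        have "B \<in> sets borel" using compl by (simp add: sig)
        then show "W \<inter> B \<in> sets \<mu>" "W \<in> sets \<mu>" using \<mu> Wb by (simp_all add: sets)
        then have "emeasure \<mu> (W \<inter> B) \<le> emeasure \<mu> W" by (intro emeasure_mono) auto
        with fin show "emeasure \<mu> (W \<inter> B) \<noteq> \<infinity>" by (auto simp: top_unique)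
      qed auto
      moreover have "W \<inter> (UNIV - B) = W - W \<inter> B" by auto
      ultimately show "(if emeasure \<mu> W < \<infinity> then emeasure \<mu> W else 0) - ?f B \<mu> = ?f (UNIV - B) \<mu>"
        by simp
    qed
  next
    case (union B)
    note [measurable] = union(3)
    have "(\<lambda>\<mu>. \<Sum>i. ?f (B i) \<mu>) \<in> borel_measurable S" by measurable
    then show ?case
    proof (rule measurable_cong[THEN iffD1, rotated])
      fix \<mu> assume \<mu>: "\<mu> \<in> space S"
      have "(\<Sum>i. emeasure \<mu> (W \<inter> B i)) = emeasure \<mu> (\<Union>i. W \<inter> B i)"
      proof (rule suminf_emeasure)
        have "B i \<in> sets borel" for i using union by (auto simp: sig)
        then show "range (\<lambda>i. W \<inter> B i) \<subseteq> sets \<mu>" using \<mu> Wb by (auto simp: sets)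
        show "disjoint_family (\<lambda>i. W \<inter> B i)"
          using union(1) unfolding disjoint_family_on_def by blast
      qed
      moreover have "(\<Union>i. W \<inter> B i) = W \<inter> (\<Union>i. B i)" by auto
      ultimately show "(\<Sum>i. ?f (B i) \<mu>) = ?f (\<Union>i. B i) \<mu>" by simp
    qed
  qed
qed

text \<open>Values on basis sets may be infinite, which would break complementation in a Dynkin argument;
  the truncation in \<open>measurable_emeasure_Int_if_finite\<close> avoids this, and it is removed again by a
  countable supremum.\<close>

lemma emeasure_eq_SUP_basis:
  fixes \<mu> :: "'a::polish_space measure"
  assumes \<mu>: "sets \<mu> = sets borel" "locally_finite_measure \<mu>"
    and \<W>: "countable \<W>" "topological_basis \<W>" "{} \<in> \<W>"
      "\<forall>F. finite F \<and> F \<subseteq> \<W> \<longrightarrow> \<Union>F \<in> \<W>"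
    and B: "B \<in> sets borel"
  shows "emeasure \<mu> B = (SUP W\<in>\<W>. if emeasure \<mu> W < \<infinity> then emeasure \<mu> (W \<inter> B) else 0)"
    (is "_ = (SUP W\<in>\<W>. ?g W)")
proof (rule antisym)
  define U where "U = from_nat_into \<W>"
  have rU: "range U = \<W>" unfolding U_def using \<W> by (intro range_from_nat_into) auto
  \<comment> \<open>Replacing basis sets of infinite measure by \<open>{}\<close> makes every finite
    union \<open>W n\<close> a basis set of finite measure; local finiteness ensures that these
    unions still exhaust the space.\<close>
  define V where "V i = (if emeasure \<mu> (U i) < \<infinity> then U i else {})" for i
  define W where "W n = (\<Union>i<n. V i)" for n
  have V: "V i \<in> \<W>" "emeasure \<mu> (V i) < \<infinity>" for i using rU \<W>(3) by (auto simp: V_def)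
  have W: "W n \<in> \<W>" for n unfolding W_def using V by (intro \<W>(4)[rule_format]) auto
  have \<W>s: "A \<in> sets \<mu>" if "A \<in> \<W>" for A
    using that \<W>(2) by (auto simp: \<mu> dest: topological_basis_open)
  have fin: "emeasure \<mu> (W n) < \<infinity>" for n
  proof -
    have "emeasure \<mu> (W n) \<le> (\<Sum>i<n. emeasure \<mu> (V i))"
      unfolding W_def using V \<W>s by (intro emeasure_subadditive_finite) auto
    also have "\<dots> < \<infinity>" using V by (simp add: ennreal_sum_less_top)
    finally show ?thesis .
  qed
  have cover: "(\<Union>n. W n) = UNIV"
  proof safe
    fix x
    obtain O' where O': "open O'" "x \<in> O'" "emeasure \<mu> O' < \<infinity>"
      using \<mu>(2) unfolding locally_finite_measure_def by blast
    then obtain A where A: "A \<in> \<W>" "x \<in> A" "A \<subseteq> O'" using topological_basisE[OF \<W>(2)] by metis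
    then obtain i where i: "U i = A" using rU by (metis rangeE)
    have "emeasure \<mu> A \<le> emeasure \<mu> O'" using A O' by (intro emeasure_mono) (auto simp: \<mu>)
    with O' have "emeasure \<mu> A < \<infinity>" by (rule_tac le_less_trans) auto
    with A i have "x \<in> V i" by (simp add: V_def)
    then have "x \<in> W (Suc i)" by (auto simp: W_def)
    then show "x \<in> (\<Union>n. W n)" by blast
  qed simp
  \<comment> \<open>Continuity from below along the exhaustion; on each \<open>W n\<close> the
    truncation is inactive.\<close>
  have "emeasure \<mu> B = emeasure \<mu> (\<Union>n. W n \<inter> B)" using cover by (metis Int_UNIV_left Int_UN_distrib2 UN_extend_simps(4))
  also have "\<dots> = (SUP n. emeasure \<mu> (W n \<inter> B))"
  proof (rule SUP_emeasure_incseq[symmetric])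
    show "range (\<lambda>n. W n \<inter> B) \<subseteq> sets \<mu>" using W \<W>s B by (auto simp: \<mu>)
    have "W m \<subseteq> W n" if "m \<le> n" for m n using that unfolding W_def by (intro UN_mono) auto
    then show "incseq (\<lambda>n. W n \<inter> B)" unfolding incseq_def by blast
  qed
  also have "\<dots> = (SUP n. ?g (W n))" using fin by simp
  also have "\<dots> \<le> (SUP W\<in>\<W>. ?g W)" using W by (intro SUP_least SUP_upper2) auto
  finally show "emeasure \<mu> B \<le> (SUP W\<in>\<W>. ?g W)" .
  show "(SUP W\<in>\<W>. ?g W) \<le> emeasure \<mu> B"
    using B by (intro SUP_least) (auto simp: \<mu> intro!: emeasure_mono)
qed

text \<open>The conditions \<open>emeasure \<mu> W \<in> J\<close>, with \<open>W\<close> and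
  \<open>J\<close> from countable bases of the space and of \<open>ennreal\<close>, suffice:
  evaluation at any Borel set is a countable supremum of functions measurable with respect to them.
  Passing to finite intersections gives a \<pi>-system, and the whole space is included so that
  uniqueness of finite measures applies.\<close>

lemma counting_space_countably_generated:
  obtains G :: "'a::polish_space measure set set"
  where "countable G" "Int_stable G" "G \<subseteq> Pow counting_measures" "counting_measures \<in> G"
    "sets counting_space = sigma_sets counting_measures G"
proof -
  obtain \<W> :: "'a set set" where \<W>: "countable \<W>" "topological_basis \<W>" "{} \<in> \<W>"
    "Int_stable \<W>" "\<forall>F. finite F \<and> F \<subseteq> \<W> \<longrightarrow> \<Union>F \<in> \<W>"
    using ex_countable_basis_lattice .
  obtain \<J> :: "ennreal set set" where \<J>: "countable \<J>" "topological_basis \<J>"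
    using ex_countable_basis by auto
  define G0 :: "'a measure set set"
    where "G0 = (\<lambda>(W, J). {\<mu> \<in> counting_measures. emeasure \<mu> W \<in> J}) ` (\<W> \<times> \<J>)"
  define S where "S = sigma counting_measures G0"
  have G0: "G0 \<subseteq> Pow counting_measures" by (auto simp: G0_def)
  have spS: "space S = counting_measures" using G0 by (simp add: S_def)
  have setsS: "sets S = sigma_sets counting_measures G0" using G0 by (simp add: S_def)
  have cm: "sets \<mu> = sets borel" "locally_finite_measure \<mu>" if "\<mu> \<in> counting_measures" for \<mu> :: "'a measure"
    using that by (auto simp: counting_measures_def)
  have basic: "(\<lambda>\<mu>. emeasure \<mu> W) \<in> borel_measurable S" if "W \<in> \<W>" for W
    unfolding borel_eq_countable_basis[OF \<J>]
  proof (rule measurable_measure_of)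
    fix J assume "J \<in> \<J>"
    then have "{\<mu> \<in> counting_measures. emeasure \<mu> W \<in> J} \<in> G0" using that by (auto simp: G0_def)
    moreover have "(\<lambda>\<mu>. emeasure \<mu> W) -` J \<inter> space S = {\<mu> \<in> counting_measures. emeasure \<mu> W \<in> J}"
      by (auto simp: spS)
    ultimately show "(\<lambda>\<mu>. emeasure \<mu> W) -` J \<inter> space S \<in> sets S" by (simp add: setsS)
  qed auto
  \<comment> \<open>Measurability of the identity expresses the inclusion of the \<sigma>-algebra of
    \<open>counting_space\<close> in that of \<open>S\<close>, the harder of the two
    inclusions.\<close>
  have "(\<lambda>\<mu>. \<mu>) \<in> S \<rightarrow>\<^sub>M (counting_space :: 'a measure measure)"
  proof (rule measurable_counting_spaceI)
    fix B :: "'a set" assume B: "B \<in> sets borel"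
    have "(\<lambda>\<mu>. SUP W\<in>\<W>. if emeasure \<mu> W < \<infinity> then emeasure \<mu> (W \<inter> B) else 0) \<in> borel_measurable S"
      using \<W>(1)
      by (intro borel_measurable_SUP measurable_emeasure_Int_if_finite[OF _ \<W>(1,2,4) basic _ B])
         (auto simp: spS cm)
    then show "(\<lambda>\<mu>. emeasure \<mu> B) \<in> borel_measurable S"
      by (rule measurable_cong[THEN iffD1, rotated])
         (intro emeasure_eq_SUP_basis[symmetric] \<W> B cm; simp add: spS)
  qed (simp add: spS)
  then have "sets counting_space \<subseteq> sets S"
    using sets.sets_into_space
    by (fastforce dest: measurable_sets simp: spS space_counting_space Int_absorb2)
  moreover have "G0 \<subseteq> sets counting_space"
  proof
    fix A assume "A \<in> G0"
    then obtain W J where A: "A = {\<mu> \<in> space counting_space. emeasure \<mu> W \<in> J}" "W \<in> \<W>" "J \<in> \<J>"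
      by (auto simp: G0_def space_counting_space)
    then have [measurable]: "W \<in> sets borel" "J \<in> sets borel"
      using topological_basis_open[OF \<W>(2)] topological_basis_open[OF \<J>(2)] by auto
    show "A \<in> sets counting_space" unfolding A(1) by measurable
  qed
  then have "sets S \<subseteq> sets (counting_space :: 'a measure measure)"
    unfolding setsS using sets.sigma_sets_subset[of G0 "counting_space :: 'a measure measure"]
    by (simp add: space_counting_space)
  ultimately have "sets (counting_space :: 'a measure measure) = sigma_sets counting_measures (finite_Inters counting_measures G0)"
    by (simp add: setsS sigma_sets_finite_Inters[OF G0])
  moreover have "countable G0" unfolding G0_def using \<W>(1) \<J>(1) by (intro countable_image countable_SIGMA)
  moreover have "Int_stable (finite_Inters counting_measures G0)"
    by (auto simp: Int_stable_def finite_Inters_Int)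
  ultimately show thesis
    by (intro that[of "finite_Inters counting_measures G0"])
       (auto simp: countable_finite_Inters space_in_finite_Inters, auto simp: finite_Inters_def)
qed

section \<open>Convolution of laws of counting measures\<close>

lemma add_measure_commute: "sets \<mu> = sets \<nu> \<Longrightarrow> add_measure \<mu> \<nu> = add_measure \<nu> \<mu>"
  by (rule measure_eqI) (simp_all add: emeasure_add_measure add.commute)

lemma
  assumes "Q \<in> space (prob_algebra counting_space)"
  shows sets_prob_algebra_counting: "sets Q = sets counting_space"
    and prob_space_prob_algebra_counting: "prob_space Q"
  using assms by (auto simp: space_prob_algebra)

lemma measurable_case_add_measure [measurable]:
  "(\<lambda>(\<mu>, \<nu>). add_measure \<mu> \<nu>) \<in>
    counting_space \<Otimes>\<^sub>M counting_space \<rightarrow>\<^sub>M (counting_space :: 'a::polish_space measure measure)"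
  by measurable

text \<open>Tonelli's theorem for the indicator of \<open>L\<close> composed with addition. The
  inner integral is the probability that a fixed \<open>\<mu>\<close> plus an
  \<open>R\<close>-distributed summand lies in \<open>L\<close>, which is the form produced by
  conditioning on one summand.\<close>

lemma emeasure_conv_law:
  fixes Q R :: "'a::polish_space measure measure"
  assumes Q: "Q \<in> space (prob_algebra counting_space)" and R: "R \<in> space (prob_algebra counting_space)"
    and L[measurable]: "L \<in> sets counting_space"
  shows "emeasure (conv_law Q R) L = (\<integral>\<^sup>+\<mu>. \<integral>\<^sup>+\<nu>. indicator L (add_measure \<mu> \<nu>) \<partial>R \<partial>Q)"
proof -
  note [measurable_cong] = sets_prob_algebra_counting[OF Q] sets_prob_algebra_counting[OF R]
  interpret R: prob_space R by (rule prob_space_prob_algebra_counting[OF R])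
  have "emeasure (conv_law Q R) L = (\<integral>\<^sup>+\<rho>. indicator L \<rho> \<partial>conv_law Q R)"
    by (simp add: conv_law_def)
  also have "\<dots> = (\<integral>\<^sup>+z. indicator L (case z of (\<mu>, \<nu>) \<Rightarrow> add_measure \<mu> \<nu>) \<partial>(Q \<Otimes>\<^sub>M R))"
    unfolding conv_law_def by (rule nn_integral_distr) measurable
  also have "\<dots> = (\<integral>\<^sup>+\<mu>. \<integral>\<^sup>+\<nu>. indicator L (add_measure \<mu> \<nu>) \<partial>R \<partial>Q)"
    by (subst R.nn_integral_fst[symmetric]) auto
  finally show ?thesis .
qed

text \<open>Swapping coordinates carries one product measure to the other, and addition is
  symmetric. This brings the second term of the mixture, obtained by exchanging the two processes,
  into the stated order.\<close>

lemma conv_law_commute: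
  fixes Q R :: "'a::polish_space measure measure"
  assumes Q: "Q \<in> space (prob_algebra counting_space)" and R: "R \<in> space (prob_algebra counting_space)"
  shows "conv_law Q R = conv_law R Q"
proof -
  note [measurable_cong] = sets_prob_algebra_counting[OF Q] sets_prob_algebra_counting[OF R]
  interpret Q: prob_space Q by (rule prob_space_prob_algebra_counting[OF Q])
  interpret R: prob_space R by (rule prob_space_prob_algebra_counting[OF R])
  interpret pair_prob_space Q R ..
  have sp: "space Q = space counting_space" "space R = space counting_space"
    using sets_prob_algebra_counting[OF Q] sets_prob_algebra_counting[OF R] by (auto dest: sets_eq_imp_space_eq)
  have "conv_law Q R = distr (distr (R \<Otimes>\<^sub>M Q) (Q \<Otimes>\<^sub>M R) (\<lambda>(x, y). (y, x))) counting_space (\<lambda>(\<mu>, \<nu>). add_measure \<mu> \<nu>)"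
    unfolding conv_law_def by (subst distr_pair_swap) simp
  also have "\<dots> = distr (R \<Otimes>\<^sub>M Q) counting_space ((\<lambda>(\<mu>, \<nu>). add_measure \<mu> \<nu>) \<circ> (\<lambda>(x, y). (y, x)))"
    by (rule distr_distr) measurable
  also have "\<dots> = conv_law R Q"
    unfolding conv_law_def
    by (rule distr_cong)
       (auto simp: space_pair_measure sp sets_counting_measures intro!: add_measure_commute)
  finally show ?thesis .
qed

text \<open>By Tonelli the value is the integral against \<open>K x\<close> of a measurable function
  not depending on \<open>x\<close>, and such integrals depend measurably on the kernel
  parameter.\<close>

lemma measurable_emeasure_conv_law:
  fixes K :: "'b \<Rightarrow> 'a::polish_space measure measure"
  assumes K[measurable]: "K \<in> N \<rightarrow>\<^sub>M prob_algebra counting_space"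
    and R: "R \<in> space (prob_algebra counting_space)" and L[measurable]: "L \<in> sets counting_space"
  shows "(\<lambda>x. emeasure (conv_law (K x) R) L) \<in> borel_measurable N"
proof -
  note [measurable_cong] = sets_prob_algebra_counting[OF R]
  interpret R: prob_space R by (rule prob_space_prob_algebra_counting[OF R])
  have [measurable]: "K \<in> N \<rightarrow>\<^sub>M subprob_algebra counting_space" by (rule measurable_prob_algebraD[OF K])
  have "(\<lambda>x. \<integral>\<^sup>+\<mu>. \<integral>\<^sup>+\<nu>. indicator L (add_measure \<mu> \<nu>) \<partial>R \<partial>K x) \<in> borel_measurable N"
    by (rule measurable_compose[OF _ nn_integral_measurable_subprob_algebra]) measurable
  then show ?thesis
    by (rule measurable_cong[THEN iffD1, rotated])
       (use measurable_space[OF K] in \<open>simp add: emeasure_conv_law R\<close>)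
qed

section \<open>The Palm formula for functions and for independent sums\<close>

text \<open>For fixed \<open>B\<close>, each side integrates \<open>f\<close> against a measure on
  the counting measures. The Palm formula for sets says that these two measures coincide, so no
  induction over \<open>f\<close> is required.\<close>

lemma palm_family_nn_integral:
  fixes \<Phi> :: "'w \<Rightarrow> 'a::polish_space measure"
  assumes \<Phi>[measurable]: "\<Phi> \<in> P \<rightarrow>\<^sub>M counting_space" and K: "palm_family P \<Phi> K"
    and B[measurable]: "B \<in> sets borel" and f[measurable]: "f \<in> borel_measurable counting_space"
  shows "(\<integral>\<^sup>+\<omega>. emeasure (\<Phi> \<omega>) B * f (\<Phi> \<omega>) \<partial>P) =
    (\<integral>\<^sup>+x\<in>B. (\<integral>\<^sup>+\<mu>. f \<mu> \<partial>K x) \<partial>moment_measure P \<Phi>)"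
proof -
  let ?M = "moment_measure P \<Phi>"
  have Kp: "K \<in> borel \<rightarrow>\<^sub>M prob_algebra counting_space" using K by (simp add: palm_family_def)
  have Ks[measurable]: "K \<in> borel \<rightarrow>\<^sub>M subprob_algebra counting_space"
    by (rule measurable_prob_algebraD[OF Kp])
  \<comment> \<open>\<open>D\<close> sends \<open>L\<close> to the Campbell measure of
    \<open>B \<times> L\<close>; \<open>E\<close> mixes the Palm kernel over the moment measure
    restricted to \<open>B\<close>.\<close>
  define D where "D = distr (density P (\<lambda>\<omega>. emeasure (\<Phi> \<omega>) B)) counting_space \<Phi>"
  define E where "E = density ?M (indicator B) \<bind> K"
  have Ed: "K \<in> density ?M (indicator B) \<rightarrow>\<^sub>M subprob_algebra counting_space" by measurable
  have "D = E"
  proof (rule measure_eqI)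
    show "sets D = sets E"
      unfolding D_def E_def by (subst sets_bind[where N=counting_space]) (simp_all add: sets_kernel[OF Ks])
    fix L assume "L \<in> sets D"
    then have L[measurable]: "L \<in> sets counting_space" by (simp add: D_def)
    have "emeasure D L = (\<integral>\<^sup>+\<rho>. indicator L \<rho> \<partial>D)" using L by (simp add: D_def)
    also have "\<dots> = (\<integral>\<^sup>+\<omega>. emeasure (\<Phi> \<omega>) B * indicator L (\<Phi> \<omega>) \<partial>P)"
      unfolding D_def by (subst nn_integral_distr) (simp_all add: nn_integral_density)
    also have "\<dots> = emeasure (campbell_measure P \<Phi>) (B \<times> L)"
      by (simp add: emeasure_campbell_measure_Times)
    also have "\<dots> = (\<integral>\<^sup>+x\<in>B. emeasure (K x) L \<partial>?M)" using K by (simp add: palm_family_def)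
    also have "\<dots> = emeasure E L"
      unfolding E_def by (subst emeasure_bind[OF _ Ed L]) (simp_all add: nn_integral_density mult.commute)
    finally show "emeasure D L = emeasure E L" .
  qed
  have "(\<integral>\<^sup>+\<omega>. emeasure (\<Phi> \<omega>) B * f (\<Phi> \<omega>) \<partial>P) = (\<integral>\<^sup>+\<mu>. f \<mu> \<partial>D)"
    unfolding D_def by (simp add: nn_integral_distr nn_integral_density)
  also have "\<dots> = (\<integral>\<^sup>+x. (\<integral>\<^sup>+\<mu>. f \<mu> \<partial>K x) \<partial>density ?M (indicator B))"
    unfolding \<open>D = E\<close> E_def by (rule nn_integral_bind[OF f Ed])
  also have "\<dots> = (\<integral>\<^sup>+x\<in>B. (\<integral>\<^sup>+\<mu>. f \<mu> \<partial>K x) \<partial>?M)"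
  proof (subst nn_integral_density)
    have "(\<lambda>x. \<integral>\<^sup>+\<mu>. f \<mu> \<partial>K x) \<in> borel_measurable borel"
      by (rule measurable_compose[OF Ks nn_integral_measurable_subprob_algebra[OF f]])
    then show "(\<lambda>x. \<integral>\<^sup>+\<mu>. f \<mu> \<partial>K x) \<in> borel_measurable ?M" by simp
  qed (simp_all add: mult.commute)
  finally show ?thesis .
qed

lemma law_in_prob_algebra: "point_process P \<Phi> \<Longrightarrow> law P \<Phi> \<in> space (prob_algebra counting_space)"
  by (auto simp: point_process_def law_def space_prob_algebra prob_space.prob_space_distr)

text \<open>Intersection and multiplication commute. It is used to exchange the roles of the two
  processes.\<close>

lemma (in prob_space) indep_var_swap:
  assumes "indep_var S X T Y"
  shows "indep_var T Y S X"
proof -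
  have "indep_set B A" if "indep_set A B" for A B
    using that unfolding indep_sets2_eq by (metis Int_commute mult.commute)
  then show ?thesis
    using assms unfolding indep_var_eq by blast
qed

text \<open>One half of the Campbell measure of the sum: the point counted in \<open>B\<close> comes
  from \<Phi>. Independence makes the joint law a product, so \<Psi> can be integrated out before
  the Palm formula of \<Phi> is applied.\<close>

lemma palm_family_conv_law:
  fixes \<Phi> \<Psi> :: "'w \<Rightarrow> 'a::polish_space measure"
  assumes pp: "point_process P \<Phi>" "point_process P \<Psi>"
    and indep: "prob_space.indep_var P counting_space \<Phi> counting_space \<Psi>"
    and K: "palm_family P \<Phi> K"
    and B[measurable]: "B \<in> sets borel" and L[measurable]: "L \<in> sets counting_space"
  shows "(\<integral>\<^sup>+\<omega>. emeasure (\<Phi> \<omega>) B * indicator L (add_measure (\<Phi> \<omega>) (\<Psi> \<omega>)) \<partial>P) =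
    (\<integral>\<^sup>+x\<in>B. emeasure (conv_law (K x) (law P \<Psi>)) L \<partial>moment_measure P \<Phi>)"
proof -
  interpret prob_space P using pp by (simp add: point_process_def)
  have \<Phi>[measurable]: "\<Phi> \<in> P \<rightarrow>\<^sub>M counting_space" and \<Psi>[measurable]: "\<Psi> \<in> P \<rightarrow>\<^sub>M counting_space"
    using pp by (auto simp: point_process_def)
  have R: "law P \<Psi> \<in> space (prob_algebra counting_space)" by (rule law_in_prob_algebra[OF pp(2)])
  note [measurable_cong] = sets_prob_algebra_counting[OF R]
  interpret R: prob_space "law P \<Psi>" by (rule prob_space_prob_algebra_counting[OF R])
  have Kp: "K x \<in> space (prob_algebra counting_space)" for x
    using K measurable_space[of K borel "prob_algebra counting_space" x] by (simp add: palm_family_def)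
  have dist: "distr P (counting_space \<Otimes>\<^sub>M counting_space) (\<lambda>\<omega>. (\<Phi> \<omega>, \<Psi> \<omega>)) = law P \<Phi> \<Otimes>\<^sub>M law P \<Psi>"
    using indep unfolding indep_var_distribution_eq law_def by simp
  \<comment> \<open>The probability that \<open>\<mu>\<close> plus an independent copy of \<Psi>
    lies in \<open>L\<close>; its integral against \<open>K x\<close> is the convolution evaluated
    at \<open>L\<close>.\<close>
  define f where "f \<mu> = (\<integral>\<^sup>+\<nu>. indicator L (add_measure \<mu> \<nu>) \<partial>law P \<Psi>)" for \<mu> :: "'a measure"
  have f[measurable]: "f \<in> borel_measurable counting_space" unfolding f_def by measurable
  have [measurable]: "(\<lambda>z. emeasure (fst z) B * indicator L (add_measure (fst z) (snd z)))
      \<in> borel_measurable (counting_space \<Otimes>\<^sub>M counting_space)"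
    by measurable
  have "(\<integral>\<^sup>+\<omega>. emeasure (\<Phi> \<omega>) B * indicator L (add_measure (\<Phi> \<omega>) (\<Psi> \<omega>)) \<partial>P) =
      (\<integral>\<^sup>+z. emeasure (fst z) B * indicator L (add_measure (fst z) (snd z)) \<partial>(law P \<Phi> \<Otimes>\<^sub>M law P \<Psi>))"
    unfolding dist[symmetric] by (subst nn_integral_distr) simp_all
  also have "\<dots> = (\<integral>\<^sup>+\<mu>. \<integral>\<^sup>+\<nu>. emeasure \<mu> B * indicator L (add_measure \<mu> \<nu>) \<partial>law P \<Psi> \<partial>law P \<Phi>)"
    by (subst R.nn_integral_fst[symmetric]) (simp_all add: law_def)
  also have "\<dots> = (\<integral>\<^sup>+\<mu>. emeasure \<mu> B * f \<mu> \<partial>law P \<Phi>)"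
    unfolding f_def by (intro nn_integral_cong nn_integral_cmult) (simp add: law_def)
  also have "\<dots> = (\<integral>\<^sup>+\<omega>. emeasure (\<Phi> \<omega>) B * f (\<Phi> \<omega>) \<partial>P)"
    unfolding law_def by (rule nn_integral_distr) measurable
  also have "\<dots> = (\<integral>\<^sup>+x\<in>B. (\<integral>\<^sup>+\<mu>. f \<mu> \<partial>K x) \<partial>moment_measure P \<Phi>)"
    by (rule palm_family_nn_integral[OF \<Phi> K B f])
  also have "\<dots> = (\<integral>\<^sup>+x\<in>B. emeasure (conv_law (K x) (law P \<Psi>)) L \<partial>moment_measure P \<Phi>)"
    by (simp add: emeasure_conv_law Kp R f_def)
  finally show ?thesis .
qed

section \<open>Sums of \<sigma>-finite measures and mixtures of laws\<close>

text \<open>Pairwise intersections of a countable finite-measure cover for each summand form a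
  countable cover on which both are finite.\<close>

lemma sigma_finite_add_measure:
  assumes "sigma_finite_measure \<mu>" "sigma_finite_measure \<nu>" and sets: "sets \<mu> = sets \<nu>"
  shows "sigma_finite_measure (add_measure \<mu> \<nu>)"
proof
  obtain C D where C: "countable C" "C \<subseteq> sets \<mu>" "\<Union>C = space \<mu>" "\<forall>a\<in>C. emeasure \<mu> a \<noteq> \<infinity>"
    and D: "countable D" "D \<subseteq> sets \<nu>" "\<Union>D = space \<nu>" "\<forall>a\<in>D. emeasure \<nu> a \<noteq> \<infinity>"
    using assms(1,2)[THEN sigma_finite_measure.sigma_finite_countable] by metis
  let ?E = "(\<lambda>(a, b). a \<inter> b) ` (C \<times> D)"
  have "emeasure (add_measure \<mu> \<nu>) (a \<inter> b) \<noteq> \<infinity>" if ab: "a \<in> C" "b \<in> D" for a b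
  proof -
    have "emeasure \<mu> (a \<inter> b) \<le> emeasure \<mu> a" "emeasure \<nu> (a \<inter> b) \<le> emeasure \<nu> b"
      using ab C D by (auto intro!: emeasure_mono)
    moreover have "emeasure \<mu> a \<noteq> \<infinity>" "emeasure \<nu> b \<noteq> \<infinity>" "a \<inter> b \<in> sets \<mu>"
      using ab C D sets by auto
    ultimately show ?thesis
      by (auto simp: emeasure_add_measure sets top_unique)
  qed
  moreover have "\<Union>?E = space \<mu>"
  proof -
    have "\<Union>?E = \<Union>C \<inter> \<Union>D" by auto
    then show ?thesis using C(3) D(3) sets_eq_imp_space_eq[OF sets] by simp
  qed
  moreover have "countable ?E" using C D by auto
  moreover have "?E \<subseteq> sets \<mu>" using C D sets by auto
  ultimately show "\<exists>A. countable A \<and> A \<subseteq> sets (add_measure \<mu> \<nu>) \<and> \<Union>A = space (add_measure \<mu> \<nu>) \<and>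
      (\<forall>a\<in>A. emeasure (add_measure \<mu> \<nu>) a \<noteq> \<infinity>)"
    by (intro exI[of _ ?E]) auto
qed

text \<open>The right-hand side is itself a measure \<open>T\<close>, built by scaling and adding,
  so uniqueness on a \<pi>-system extends the identity. Since \<open>\<Omega> \<in> G\<close> has
  finite mass under \<open>Q\<close>, the constant sequence \<open>\<Omega>\<close> serves as the
  exhaustion.\<close>

lemma prob_mixture_eqI:
  fixes Q R\<^sub>1 R\<^sub>2 :: "'a measure" and a b :: real
  assumes "prob_space Q"
    and sets: "sets Q = sigma_sets \<Omega> G" "sets R\<^sub>1 = sigma_sets \<Omega> G" "sets R\<^sub>2 = sigma_sets \<Omega> G"
    and G: "Int_stable G" "G \<subseteq> Pow \<Omega>" "\<Omega> \<in> G"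
    and eq: "\<And>A. A \<in> G \<Longrightarrow> emeasure Q A = ennreal a * emeasure R\<^sub>1 A + ennreal b * emeasure R\<^sub>2 A"
    and A: "A \<in> sets Q"
  shows "emeasure Q A = ennreal a * emeasure R\<^sub>1 A + ennreal b * emeasure R\<^sub>2 A"
proof -
  interpret Q: prob_space Q by fact
  define T where "T = add_measure (scale_measure (ennreal a) R\<^sub>1) (scale_measure (ennreal b) R\<^sub>2)"
  have T: "emeasure T X = ennreal a * emeasure R\<^sub>1 X + ennreal b * emeasure R\<^sub>2 X" if "X \<in> sigma_sets \<Omega> G" for X
    using that sets by (simp add: T_def emeasure_add_measure)
  have "Q = T"
  proof (rule measure_eqI_generator_eq[OF G(1,2), where A="\<lambda>_. \<Omega>"])
    show "emeasure Q X = emeasure T X" if "X \<in> G" for X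
      using that by (simp add: eq T sigma_sets.Basic)
    show "emeasure Q \<Omega> \<noteq> \<infinity>" by simp
  qed (use G(3) in \<open>auto simp: sets T_def\<close>)
  with T A sets show ?thesis by simp
qed

section \<open>The mixture formula for the Palm distributions of an independent sum\<close>

theorem theorem1:
  fixes P :: "'w measure"
    and \<Phi>\<^sub>1 \<Phi>\<^sub>2 :: "'w \<Rightarrow> 'a::polish_space measure"
    and p\<^sub>1 p\<^sub>2 :: "'a \<Rightarrow> real"
    and K K\<^sub>1 K\<^sub>2 :: "'a \<Rightarrow> 'a measure measure"
  defines "\<Phi> \<equiv> (\<lambda>\<omega>. add_measure (\<Phi>\<^sub>1 \<omega>) (\<Phi>\<^sub>2 \<omega>))"
    and "M \<equiv> add_measure (moment_measure P \<Phi>\<^sub>1) (moment_measure P \<Phi>\<^sub>2)"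
  assumes "point_process P \<Phi>\<^sub>1" and "point_process P \<Phi>\<^sub>2"
    and "prob_space.indep_var P counting_space \<Phi>\<^sub>1 counting_space \<Phi>\<^sub>2"
    and "sigma_finite_measure (moment_measure P \<Phi>\<^sub>1)"
    and "sigma_finite_measure (moment_measure P \<Phi>\<^sub>2)"
    and "p\<^sub>1 \<in> borel_measurable borel" and "p\<^sub>2 \<in> borel_measurable borel"
    and "density M (\<lambda>x. ennreal (p\<^sub>1 x)) = moment_measure P \<Phi>\<^sub>1"
    and "density M (\<lambda>x. ennreal (p\<^sub>2 x)) = moment_measure P \<Phi>\<^sub>2"
    and "\<And>x. p\<^sub>1 x \<ge> 0" and "\<And>x. p\<^sub>2 x \<ge> 0" and "\<And>x. p\<^sub>1 x + p\<^sub>2 x = 1"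
    and "palm_family P \<Phi> K"
    and "palm_family P \<Phi>\<^sub>1 K\<^sub>1"
    and "palm_family P \<Phi>\<^sub>2 K\<^sub>2"
  shows "AE x in moment_measure P \<Phi>. \<forall>L\<in>sets counting_space.
    emeasure (K x) L =
      ennreal (p\<^sub>1 x) * emeasure (conv_law (K\<^sub>1 x) (law P \<Phi>\<^sub>2)) L +
      ennreal (p\<^sub>2 x) * emeasure (conv_law (law P \<Phi>\<^sub>1) (K\<^sub>2 x)) L"
proof -
  note pp = \<open>point_process P \<Phi>\<^sub>1\<close> \<open>point_process P \<Phi>\<^sub>2\<close>
  note indep = \<open>prob_space.indep_var P counting_space \<Phi>\<^sub>1 counting_space \<Phi>\<^sub>2\<close>
  note palm = \<open>palm_family P \<Phi> K\<close> \<open>palm_family P \<Phi>\<^sub>1 K\<^sub>1\<close> \<open>palm_family P \<Phi>\<^sub>2 K\<^sub>2\<close>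
  note [measurable] = \<open>p\<^sub>1 \<in> borel_measurable borel\<close> \<open>p\<^sub>2 \<in> borel_measurable borel\<close>
  let ?N = "counting_space :: 'a measure measure"
  let ?Q\<^sub>1 = "law P \<Phi>\<^sub>1" and ?Q\<^sub>2 = "law P \<Phi>\<^sub>2"
  have prob: "prob_space P" using pp by (simp add: point_process_def)
  have [measurable]: "\<Phi>\<^sub>1 \<in> P \<rightarrow>\<^sub>M ?N" "\<Phi>\<^sub>2 \<in> P \<rightarrow>\<^sub>M ?N" "\<Phi> \<in> P \<rightarrow>\<^sub>M ?N"
    using pp point_process_add[OF pp] by (auto simp: point_process_def \<Phi>_def)
  have MM: "moment_measure P \<Phi> = M" unfolding \<Phi>_def M_def by (rule moment_measure_add) measurable
  have sM[measurable_cong]: "sets M = sets borel" by (simp add: M_def)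
  interpret M: sigma_finite_measure M
    unfolding M_def by (rule sigma_finite_add_measure) (use assms in simp_all)
  note Q = law_in_prob_algebra[OF pp(1)] law_in_prob_algebra[OF pp(2)]
  have Km: "K \<in> borel \<rightarrow>\<^sub>M prob_algebra ?N" "K\<^sub>1 \<in> borel \<rightarrow>\<^sub>M prob_algebra ?N" "K\<^sub>2 \<in> borel \<rightarrow>\<^sub>M prob_algebra ?N"
    using palm by (auto simp: palm_family_def)
  have Kp: "K x \<in> space (prob_algebra ?N)" "K\<^sub>1 x \<in> space (prob_algebra ?N)" "K\<^sub>2 x \<in> space (prob_algebra ?N)" for x
    using Km[THEN measurable_space] by auto
  define c\<^sub>1 where "c\<^sub>1 L x = emeasure (conv_law (K\<^sub>1 x) ?Q\<^sub>2) L" for L x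
  \<comment> \<open>The Palm kernel stands first here, as \<open>palm_family_conv_law\<close>
    produces it with the processes exchanged; the order is reversed at the end.\<close>
  define c\<^sub>2 where "c\<^sub>2 L x = emeasure (conv_law (K\<^sub>2 x) ?Q\<^sub>1) L" for L x
  have AE_L: "AE x in M. emeasure (K x) L = ennreal (p\<^sub>1 x) * c\<^sub>1 L x + ennreal (p\<^sub>2 x) * c\<^sub>2 L x"
    if L[measurable]: "L \<in> sets ?N" for L
  \<comment> \<open>Densities with respect to the \<sigma>-finite \<open>M\<close> are unique almost
    everywhere, so it is enough that both sides have equal integrals over every Borel set
    \<open>B\<close>. The exceptional set may still depend on \<open>L\<close>.\<close>
  proof (rule M.density_unique)
    have [measurable]: "c\<^sub>1 L \<in> borel_measurable borel" "c\<^sub>2 L \<in> borel_measurable borel"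
      unfolding c\<^sub>1_def c\<^sub>2_def using Km Q by (auto intro!: measurable_emeasure_conv_law)
    have [measurable]: "(\<lambda>x. emeasure (K x) L) \<in> borel_measurable borel"
      by (rule measurable_compose[OF measurable_prob_algebraD[OF Km(1)] measurable_emeasure_subprob_algebra[OF L]])
    show "(\<lambda>x. emeasure (K x) L) \<in> borel_measurable M"
      "(\<lambda>x. ennreal (p\<^sub>1 x) * c\<^sub>1 L x + ennreal (p\<^sub>2 x) * c\<^sub>2 L x) \<in> borel_measurable M"
      by measurable
    show "density M (\<lambda>x. emeasure (K x) L) =
        density M (\<lambda>x. ennreal (p\<^sub>1 x) * c\<^sub>1 L x + ennreal (p\<^sub>2 x) * c\<^sub>2 L x)"
    proof (rule measure_eqI)
      fix B assume "B \<in> sets (density M (\<lambda>x. emeasure (K x) L))"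
      then have B[measurable]: "B \<in> sets borel" by (simp add: sM)
      have sets\<Phi>: "sets (\<Phi>\<^sub>1 \<omega>) = sets borel" "sets (\<Phi>\<^sub>2 \<omega>) = sets borel" if "\<omega> \<in> space P" for \<omega>
        using that measurable_space[of _ P ?N] by (auto intro!: sets_counting_measures)
      \<comment> \<open>Points of the first process: the density \<open>p\<^sub>1\<close> converts
        the integral over its moment measure into one over \<open>M\<close>.\<close>
      have I\<^sub>1: "(\<integral>\<^sup>+\<omega>. emeasure (\<Phi>\<^sub>1 \<omega>) B * indicator L (\<Phi> \<omega>) \<partial>P) =
          (\<integral>\<^sup>+x. ennreal (p\<^sub>1 x) * c\<^sub>1 L x * indicator B x \<partial>M)"
      proof -
        have "(\<integral>\<^sup>+\<omega>. emeasure (\<Phi>\<^sub>1 \<omega>) B * indicator L (\<Phi> \<omega>) \<partial>P) = (\<integral>\<^sup>+x\<in>B. c\<^sub>1 L x \<partial>moment_measure P \<Phi>\<^sub>1)"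
          unfolding \<Phi>_def c\<^sub>1_def by (rule palm_family_conv_law[OF pp indep palm(2) B L])
        also have "\<dots> = (\<integral>\<^sup>+x. ennreal (p\<^sub>1 x) * c\<^sub>1 L x * indicator B x \<partial>M)"
          unfolding \<open>density M (\<lambda>x. ennreal (p\<^sub>1 x)) = moment_measure P \<Phi>\<^sub>1\<close>[symmetric]
          by (subst nn_integral_density) (simp_all add: mult.assoc)
        finally show ?thesis .
      qed
      have I\<^sub>2: "(\<integral>\<^sup>+\<omega>. emeasure (\<Phi>\<^sub>2 \<omega>) B * indicator L (\<Phi> \<omega>) \<partial>P) =
          (\<integral>\<^sup>+x. ennreal (p\<^sub>2 x) * c\<^sub>2 L x * indicator B x \<partial>M)"
      proof -
        have "(\<integral>\<^sup>+\<omega>. emeasure (\<Phi>\<^sub>2 \<omega>) B * indicator L (\<Phi> \<omega>) \<partial>P) =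
            (\<integral>\<^sup>+\<omega>. emeasure (\<Phi>\<^sub>2 \<omega>) B * indicator L (add_measure (\<Phi>\<^sub>2 \<omega>) (\<Phi>\<^sub>1 \<omega>)) \<partial>P)"
          unfolding \<Phi>_def by (intro nn_integral_cong) (simp add: add_measure_commute sets\<Phi>)
        also have "\<dots> = (\<integral>\<^sup>+x\<in>B. c\<^sub>2 L x \<partial>moment_measure P \<Phi>\<^sub>2)"
          unfolding c\<^sub>2_def
          by (rule palm_family_conv_law[OF pp(2,1) prob_space.indep_var_swap[OF prob indep] palm(3) B L])
        also have "\<dots> = (\<integral>\<^sup>+x. ennreal (p\<^sub>2 x) * c\<^sub>2 L x * indicator B x \<partial>M)"
          unfolding \<open>density M (\<lambda>x. ennreal (p\<^sub>2 x)) = moment_measure P \<Phi>\<^sub>2\<close>[symmetric]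
          by (subst nn_integral_density) (simp_all add: mult.assoc)
        finally show ?thesis .
      qed
      have "emeasure (density M (\<lambda>x. emeasure (K x) L)) B = (\<integral>\<^sup>+x\<in>B. emeasure (K x) L \<partial>M)"
        by (simp add: emeasure_density)
      also have "\<dots> = emeasure (campbell_measure P \<Phi>) (B \<times> L)"
        using palm(1) B L by (simp add: palm_family_def MM)
      also have "\<dots> = (\<integral>\<^sup>+\<omega>. emeasure (\<Phi> \<omega>) B * indicator L (\<Phi> \<omega>) \<partial>P)"
        by (rule emeasure_campbell_measure_Times) measurable
      \<comment> \<open>A point of the sum belongs to one of the two summands, so the Campbell
        measure splits into the quantities computed in \<open>I\<^sub>1\<close> and
        \<open>I\<^sub>2\<close>.\<close>
      also have "\<dots> = (\<integral>\<^sup>+\<omega>. emeasure (\<Phi>\<^sub>1 \<omega>) B * indicator L (\<Phi> \<omega>) + emeasure (\<Phi>\<^sub>2 \<omega>) B * indicator L (\<Phi> \<omega>) \<partial>P)"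
        by (intro nn_integral_cong) (simp add: \<Phi>_def emeasure_add_measure sets\<Phi> distrib_right)
      also have "\<dots> = (\<integral>\<^sup>+\<omega>. emeasure (\<Phi>\<^sub>1 \<omega>) B * indicator L (\<Phi> \<omega>) \<partial>P) +
          (\<integral>\<^sup>+\<omega>. emeasure (\<Phi>\<^sub>2 \<omega>) B * indicator L (\<Phi> \<omega>) \<partial>P)"
        by (intro nn_integral_add) measurable
      also have "\<dots> = (\<integral>\<^sup>+x. ennreal (p\<^sub>1 x) * c\<^sub>1 L x * indicator B x + ennreal (p\<^sub>2 x) * c\<^sub>2 L x * indicator B x \<partial>M)"
        unfolding I\<^sub>1 I\<^sub>2 by (intro nn_integral_add[symmetric]) measurable
      also have "\<dots> = emeasure (density M (\<lambda>x. ennreal (p\<^sub>1 x) * c\<^sub>1 L x + ennreal (p\<^sub>2 x) * c\<^sub>2 L x)) B"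
        by (simp add: emeasure_density distrib_right)
      finally show "emeasure (density M (\<lambda>x. emeasure (K x) L)) B =
        emeasure (density M (\<lambda>x. ennreal (p\<^sub>1 x) * c\<^sub>1 L x + ennreal (p\<^sub>2 x) * c\<^sub>2 L x)) B" .
    qed simp
  qed
  obtain G :: "'a measure set set" where G: "countable G" "Int_stable G" "G \<subseteq> Pow counting_measures"
    "counting_measures \<in> G" "sets ?N = sigma_sets counting_measures G"
    using counting_space_countably_generated .
  \<comment> \<open>Only countably many sets \<open>L\<close> are involved, so their exceptional
    null sets combine into a single one.\<close>
  have "AE x in M. \<forall>L\<in>G. emeasure (K x) L = ennreal (p\<^sub>1 x) * c\<^sub>1 L x + ennreal (p\<^sub>2 x) * c\<^sub>2 L x"
    using G by (auto simp: AE_ball_countable intro!: AE_L)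
  then have "AE x in M. \<forall>L\<in>sets ?N. emeasure (K x) L = ennreal (p\<^sub>1 x) * c\<^sub>1 L x + ennreal (p\<^sub>2 x) * c\<^sub>2 L x"
  proof (rule AE_mp, intro AE_I2 impI ballI)
    fix x L
    assume G_eq: "\<forall>L\<in>G. emeasure (K x) L = ennreal (p\<^sub>1 x) * c\<^sub>1 L x + ennreal (p\<^sub>2 x) * c\<^sub>2 L x"
      and L: "L \<in> sets ?N"
    show "emeasure (K x) L = ennreal (p\<^sub>1 x) * c\<^sub>1 L x + ennreal (p\<^sub>2 x) * c\<^sub>2 L x"
      unfolding c\<^sub>1_def c\<^sub>2_def
    \<comment> \<open>With \<open>x\<close> fixed outside the common null set, agreement on the
      \<pi>-system \<open>G\<close> extends to all measurable \<open>L\<close>.\<close>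
    proof (rule prob_mixture_eqI[OF _ _ _ _ G(2,3,4)])
      show "prob_space (K x)" by (rule prob_space_prob_algebra_counting[OF Kp(1)])
    qed (use G_eq L G(5) in \<open>simp_all add: sets_prob_algebra_counting[OF Kp(1)] conv_law_def c\<^sub>1_def c\<^sub>2_def\<close>)
  qed
  then show ?thesis
    unfolding MM c\<^sub>1_def c\<^sub>2_def conv_law_commute[OF Kp(3) Q(1)] .
qed

end
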